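(* Let $n\ge 1$ and let $a_1,\dots,a_n$ be nonnegative integers (repetitions allowed), each of whose SSGS expressions has at most eight squares. For each $i$ write the SSGS expression as $$a_i=p_{i0}^2+p_{i1}^2+\cdots+p_{i7}^2,$$ where $p_{i0},p_{i1},\dots,p_{i7}$ are the successive nonnegative integers produced by the SSGS scheme (padded with zeros up to eight terms). For $k=0,\dots,7$ let $\overline{p_k}=\frac1n\sum_{i=1}^n p_{ik}$ be the arithmetic average of the $k$-th coefficients, and let $$\overline{p}=\varepsilon_0\overline{p_0}+\sum_{k=1}^{6}\varepsilon_k\overline{p_k}+\varepsilon_7(\mathrm{i}\,\overline{p_7}),\qquad \overline{p}^{\,c}=\varepsilon_0\overline{p_0}-\sum_{k=1}^{6}\varepsilon_k\overline{p_k}-\varepsilon_7(\mathrm{i}\,\overline{p_7})$$ be the mutually conjugate Clifford numbers with these averaged coefficients. Then the arithmetic average of the $a_i$ is greater than or equal to the product $\overline{p}\,\overline{p}^{\,c}$, where this product is the real number $\sum_{k=0}^{7}\overline{p_k}^{\,2}$; that is, $$\frac1n\sum_{i=1}^n a_i\;\ge\;\overline{p}\,\overline{p}^{\,c}=\sum_{k=0}^{7}\left(\frac1n\sum_{i=1}^n p_{ik}\right)^2 .$$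
   Context: SSGS expression of a nonnegative integer $x$: let $x_1$ be the largest nonnegative integer with $x_1^2\le x$ (so $x_1^2\le x<(x_1+1)^2$); $x_1^2$ is called the significant square. Put $R_1=x-x_1^2$. Let $x_2$ be the largest nonnegative integer with $x_2^2\le R_1$, put $R_2=R_1-x_2^2$, and continue in the same way until the residue is zero. This gives a unique expression $x=x_1^2+x_2^2+\cdots+x_m^2$ (the squares after the first are called generation squares). If $m\le 8$, set $p_0=x_1,\ p_1=x_2,\dots,p_{m-1}=x_m$ and $p_k=0$ for $m\le k\le 7$. Clifford numbers: the bases are $\varepsilon_0$ (the unit), $\varepsilon_1,\varepsilon_2,\varepsilon_3$, $\varepsilon_4=\varepsilon_1\wedge\varepsilon_2$, $\varepsilon_5=\varepsilon_2\wedge\varepsilon_3$, $\varepsilon_6=\varepsilon_3\wedge\varepsilon_1$, $\varepsilon_7=\varepsilon_1\wedge\varepsilon_2\wedge\varepsilon_3$ of $Cl(0,3)$, with $\varepsilon_0^2=+1$, $\varepsilon_1^2=\cdots=\varepsilon_6^2=-1$, $\varepsilon_7^2=+1$; the coefficient of $\varepsilon_7$ is taken to be purely imaginary, with $\mathrm{i}=\sqrt{-1}$. For real numbers $p_0,\dots,p_7$, the Clifford number with coefficients $p_0,\dots,p_7$ is $p=\varepsilon_0p_0+\sum_{k=1}^6\varepsilon_kp_k+\varepsilon_7(\mathrm{i}p_7)$, and its conjugate is $p^c=\varepsilon_0p_0-\sum_{k=1}^6\varepsilon_kp_k-\varepsilon_7(\mathrm{i}p_7)$. Convention for the product: the product of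 such a mutually conjugate pair is evaluated as the real number $p\,p^c=p_0^2+p_1^2+\cdots+p_7^2$ (this equals the scalar part, i.e. the $\varepsilon_0$-coefficient, of the Clifford product). *)

theory Defs
  imports Complex_Main "HOL-Library.Discrete_Functions"
begin

section \<open>SSGS expressions\<close>

text \<open>The list of successive greedy roots; \<open>floor_sqrt x\<close> is the largest \<open>m\<close> with
  \<open>m\<^sup>2 \<le> x\<close>. The truncated subtraction is exact by \<open>floor_sqrt_power2_le\<close>.\<close>

function ssgs :: "nat \<Rightarrow> nat list" where
  "ssgs x =
    (let r = floor_sqrt x; R = x - r\<^sup>2
     in r # (if R = 0 then [] else ssgs R))"
  by pat_completeness auto
termination
  by (relation "measure id") (auto simp: floor_sqrt_power2_le)

declare ssgs.simps [simp del]

lemma ssgs_sum_squares: "(\<Sum>r\<leftarrow>ssgs x. r\<^sup>2) = x"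
proof (induction x rule: ssgs.induct)
  case (1 x)
  show ?case
    using 1 floor_sqrt_power2_le[of x]
    by (subst ssgs.simps) (auto simp: Let_def intro: le_antisym)
qed

definition ssgs_coeff :: "nat \<Rightarrow> nat \<Rightarrow> nat" where
  "ssgs_coeff x k = (if k < length (ssgs x) then ssgs x ! k else 0)"


section \<open>The Clifford algebra \<open>Cl(0,3)\<close> with complex coefficients\<close>

text \<open>A multivector is given by its coefficients with respect to the blades
  \<open>e\<^sub>A = e\<^sub>i \<cdots> e\<^sub>j\<close> (increasing indices), \<open>A \<subseteq> {1, 2, 3}\<close>. Moving the factors of
  \<open>e\<^sub>A e\<^sub>B\<close> into increasing order contributes one sign for each inversion, and one for each
  repeated generator, as all generators square to \<open>-1\<close>.\<close>

type_synonym clifford = "nat set \<Rightarrow> complex"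

definition blade :: "nat set \<Rightarrow> clifford" where
  "blade A = (\<lambda>C. if C = A then 1 else 0)"

definition blade_sign :: "nat set \<Rightarrow> nat set \<Rightarrow> complex" where
  "blade_sign A B = (-1) ^ (card {(a, b) \<in> A \<times> B. b < a} + card (A \<inter> B))"

definition cl_mult :: "clifford \<Rightarrow> clifford \<Rightarrow> clifford" where
  "cl_mult x y = (\<lambda>C. \<Sum>A\<in>Pow {1, 2, 3}. \<Sum>B\<in>Pow {1, 2, 3}.
     if (A - B) \<union> (B - A) = C then blade_sign A B * x A * y B else 0)"

definition cl_wedge :: "clifford \<Rightarrow> clifford \<Rightarrow> clifford" where
  "cl_wedge x y = (\<lambda>C. \<Sum>A\<in>Pow {1, 2, 3}. \<Sum>B\<in>Pow {1, 2, 3}.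
     if A \<inter> B = {} \<and> A \<union> B = C then blade_sign A B * x A * y B else 0)"

definition scalar_part :: "clifford \<Rightarrow> complex" where
  "scalar_part x = x {}"

definition eps :: "nat \<Rightarrow> clifford" where
  "eps k =
    (if k = 0 then blade {}
     else if k = 1 then blade {1}
     else if k = 2 then blade {2}
     else if k = 3 then blade {3}
     else if k = 4 then cl_wedge (blade {1}) (blade {2})
     else if k = 5 then cl_wedge (blade {2}) (blade {3})
     else if k = 6 then cl_wedge (blade {3}) (blade {1})
     else if k = 7 then cl_wedge (cl_wedge (blade {1}) (blade {2})) (blade {3})
     else (\<lambda>_. 0))"

definition cliff :: "(nat \<Rightarrow> real) \<Rightarrow> clifford" where
  "cliff p = (\<lambda>A. eps 0 A * of_real (p 0) + (\<Sum>k=1..6. eps k A * of_real (p k))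
                 + eps 7 A * (\<i> * of_real (p 7)))"

definition cliff_conj :: "(nat \<Rightarrow> real) \<Rightarrow> clifford" where
  "cliff_conj p = (\<lambda>A. eps 0 A * of_real (p 0) - (\<Sum>k=1..6. eps k A * of_real (p k))
                      - eps 7 A * (\<i> * of_real (p 7)))"

text \<open>By convention, the product of a mutually conjugate pair is the scalar part of the
  Clifford product; the other components are disregarded.\<close>

definition conj_pair_prod :: "(nat \<Rightarrow> real) \<Rightarrow> complex" where
  "conj_pair_prod p = scalar_part (cl_mult (cliff p) (cliff_conj p))"

end

theory Submission
  imports Defs "HOL-Analysis.Convex"
begin

text \<open>
  The scalar part of a Clifford product only sees pairs of equal blades, so the product of a
  conjugate pair is a signed sum of squares of the eight coefficients. A blade of grade \<open>g\<close>
  squares to \<open>(-1)\<close> to the power \<open>g (g + 1) / 2\<close>, which is \<open>1\<close> for the unit, \<open>-1\<close> for the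
  grades 1 and 2, and \<open>1\<close> for the pseudoscalar. Conjugation reverses the sign of everything
  but the unit, which makes the grades 1 and 2 contribute positively; the pseudoscalar would
  contribute negatively, and its imaginary coefficient corrects just this. All eight signs are
  therefore positive (\<open>conj_pair_prod_eq_sum_squares\<close>).

  The inequality is then coordinatewise: the square of a mean is at most the mean of the
  squares (\<open>square_mean_le_mean_square\<close>), and summing the squares over the eight coordinates of
  the SSGS expression of \<open>a\<^sub>i\<close> gives back \<open>a\<^sub>i\<close> (\<open>sum_ssgs_coeff_squares\<close>).
\<close>

section \<open>The product of a conjugate pair\<close>

text \<open>The pairs in \<open>A \<times> A\<close> below, above and on the diagonal partition the square, and the first two
  classes are exchanged by swapping.\<close>

lemma card_inversions_self:
  fixes A :: "nat set"
  assumes "finite A"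
  shows "card {(a, b) \<in> A \<times> A. b < a} = card A choose 2"
proof -
  let ?I = "{(a, b) \<in> A \<times> A. b < a}" and ?J = "{(a, b) \<in> A \<times> A. a < b}"
  have fin: "finite ?I" "finite ?J"
    using assms by (auto intro: finite_subset[of _ "A \<times> A"])
  have "?J = prod.swap ` ?I"
    by (auto simp: image_iff)
  hence J: "card ?J = card ?I"
    by (simp add: card_image)
  have "card A * card A = card (A \<times> A)"
    by (simp add: card_cartesian_product)
  also have "A \<times> A = (?I \<union> ?J) \<union> (\<lambda>a. (a, a)) ` A"
    by auto
  also have "card \<dots> = card (?I \<union> ?J) + card ((\<lambda>a. (a, a)) ` A)"
    using assms fin by (intro card_Un_disjoint) auto
  also have "card (?I \<union> ?J) = card ?I + card ?J"
    using fin by (intro card_Un_disjoint) auto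
  also have "card ((\<lambda>a. (a, a)) ` A) = card A"
    by (intro card_image inj_onI) auto
  finally have "card A * (card A - 1) = 2 * card ?I"
    using J by (simp add: algebra_simps diff_mult_distrib2)
  thus ?thesis
    by (simp add: choose_two)
qed

lemma blade_sign_self:
  "finite A \<Longrightarrow> blade_sign A A = (-1) ^ (Suc (card A) choose 2)"
  unfolding blade_sign_def
  by (simp only: card_inversions_self Int_absorb) (simp add: numeral_2_eq_2 add.commute)

lemma blade_sign_square: "(blade_sign A B)\<^sup>2 = 1"
  by (simp add: blade_sign_def flip: power_mult)

text \<open>The scalar factor \<open>s\<close> makes the rule applicable again to its own result, as iterated wedge
  products require.\<close>

lemma cl_wedge_blade:
  assumes "A \<subseteq> {1, 2, 3}" "B \<subseteq> {1, 2, 3}" "A \<inter> B = {}"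
  shows "cl_wedge (\<lambda>C. s * blade A C) (blade B) = (\<lambda>C. s * blade_sign A B * blade (A \<union> B) C)"
proof
  fix C
  have "cl_wedge (\<lambda>C. s * blade A C) (blade B) C =
      (\<Sum>X\<in>Pow {1, 2, 3}. if X = A then \<Sum>Y\<in>Pow {1, 2, 3}.
         if Y = B then s * blade_sign A B * blade (A \<union> B) C else 0 else 0)"
    unfolding cl_wedge_def
  proof (intro sum.cong refl)
    fix X
    show "(\<Sum>Y\<in>Pow {1, 2, 3}. if X \<inter> Y = {} \<and> X \<union> Y = C
          then blade_sign X Y * (s * blade A X) * blade B Y else 0) =
        (if X = A then \<Sum>Y\<in>Pow {1, 2, 3}.
          if Y = B then s * blade_sign A B * blade (A \<union> B) C else 0 else 0)"
    proof (cases "X = A")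
      case True
      show ?thesis
        unfolding True if_P[OF refl[of A]]
        using assms(3) by (intro sum.cong refl) (simp add: blade_def)
    next
      case False
      thus ?thesis
        by (simp add: blade_def cong: if_cong)
    qed
  qed
  also have "\<dots> = s * blade_sign A B * blade (A \<union> B) C"
    using assms(1,2) by (simp only: sum.delta finite_Pow_iff finite.intros Pow_iff if_True)
  finally show "cl_wedge (\<lambda>C. s * blade A C) (blade B) C = s * blade_sign A B * blade (A \<union> B) C" .
qed

text \<open>The product of two blades is a multiple of the blade of the symmetric difference, which is
  the unit only if the blades agree.\<close>

lemma scalar_part_cl_mult:
  "scalar_part (cl_mult x y) = (\<Sum>A\<in>Pow {1, 2, 3}. blade_sign A A * x A * y A)"
proof -
  have "(A - B) \<union> (B - A) = {} \<longleftrightarrow> A = B" for A B :: "nat set"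
    by blast
  thus ?thesis
    by (simp add: scalar_part_def cl_mult_def del: Un_empty)
qed

lemma distinct_subsets_123:
  "distinct [{}, {1}, {2}, {3}, {1, 2}, {2, 3}, {1, 3}, {1, 2, 3 :: nat}]"
  (is "distinct ?L")
proof -
  \<comment> \<open>Comparing membership vectors reduces inequality of sets to propositional logic.\<close>
  have "distinct (map (\<lambda>A. (1 \<in> A, 2 \<in> A, 3 \<in> A)) ?L)"
    by simp
  thus ?thesis
    unfolding distinct_map by blast
qed

lemma sum_Pow_123:
  fixes f :: "nat set \<Rightarrow> 'a::comm_monoid_add"
  shows "(\<Sum>A\<in>Pow {1, 2, 3}. f A) =
    f {} + f {1} + f {2} + f {3} + f {1, 2} + f {2, 3} + f {1, 3} + f {1, 2, 3}"
proof -
  let ?L = "[{}, {1}, {2}, {3}, {1, 2}, {2, 3}, {1, 3}, {1, 2, 3 :: nat}]"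
  have "Pow {1, 2, 3} = set ?L"
    by (auto simp: Pow_insert)
  thus ?thesis
    by (simp only: sum.distinct_set_conv_list[OF distinct_subsets_123]) (simp add: add.assoc)
qed

text \<open>The bases defined by wedge products are blades up to a sign; for example, the wedge of
  \<open>e\<^sub>3\<close> and \<open>e\<^sub>1\<close> is the negative of the blade of \<open>{1, 3}\<close>. As each of these signs enters both
  factors of the product, only its square survives, so the signs are left unevaluated.\<close>

lemma conj_pair_prod_eq_sum_squares:
  "conj_pair_prod p = complex_of_real (\<Sum>k=0..7. (p k)\<^sup>2)"
proof -
  let ?s4 = "blade_sign {1} {2}" and ?s5 = "blade_sign {2} {3}" and ?s6 = "blade_sign {3} {1}"
  let ?s7 = "?s4 * blade_sign {1, 2} {3}"
  have eps_simps: "eps 0 = blade {}" "eps 1 = blade {1}" "eps 2 = blade {2}" "eps 3 = blade {3}"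
    by (simp_all add: eps_def)
  have eps_wedge: "eps 4 = (\<lambda>C. ?s4 * blade {1, 2} C)" "eps 5 = (\<lambda>C. ?s5 * blade {2, 3} C)"
    "eps 6 = (\<lambda>C. ?s6 * blade {1, 3} C)" "eps 7 = (\<lambda>C. ?s7 * blade {1, 2, 3} C)"
    using cl_wedge_blade[of "{1}" "{2}" 1] cl_wedge_blade[of "{2}" "{3}" 1]
      cl_wedge_blade[of "{3}" "{1}" 1] cl_wedge_blade[of "{1, 2}" "{3}" ?s4]
    by (simp_all add: eps_def insert_commute)
  have six: "{1..6::nat} = {1, 2, 3, 4, 5, 6}" and seven: "{0..7::nat} = {0, 1, 2, 3, 4, 5, 6, 7}"
    by auto
  define x y where "x = cliff p" and "y = cliff_conj p"
  have x: "x {} = p 0" "x {1} = p 1" "x {2} = p 2" "x {3} = p 3" "x {1, 2} = ?s4 * p 4"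
    "x {2, 3} = ?s5 * p 5" "x {1, 3} = ?s6 * p 6" "x {1, 2, 3} = ?s7 * (\<i> * p 7)"
    unfolding x_def cliff_def six eps_simps
    using distinct_subsets_123 distinct_rev[THEN iffD2, OF distinct_subsets_123]
    by (simp_all add: eps_simps[unfolded One_nat_def] eps_wedge blade_def)
  have y: "y {} = p 0" "y {1} = - p 1" "y {2} = - p 2" "y {3} = - p 3" "y {1, 2} = - (?s4 * p 4)"
    "y {2, 3} = - (?s5 * p 5)" "y {1, 3} = - (?s6 * p 6)" "y {1, 2, 3} = - (?s7 * (\<i> * p 7))"
    unfolding y_def cliff_conj_def six eps_simps
    using distinct_subsets_123 distinct_rev[THEN iffD2, OF distinct_subsets_123]
    by (simp_all add: eps_simps[unfolded One_nat_def] eps_wedge blade_def)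
  have sgn: "blade_sign {} {} = 1" "blade_sign {1} {1} = -1" "blade_sign {2} {2} = -1"
    "blade_sign {3} {3} = -1" "blade_sign {1, 2} {1, 2} = -1" "blade_sign {2, 3} {2, 3} = -1"
    "blade_sign {1, 3} {1, 3} = -1" "blade_sign {1, 2, 3} {1, 2, 3} = 1"
    by (simp_all add: blade_sign_self choose_two)
  have "conj_pair_prod p = (p 0)\<^sup>2 + (p 1)\<^sup>2 + (p 2)\<^sup>2 + (p 3)\<^sup>2 + ?s4\<^sup>2 * (p 4)\<^sup>2
      + ?s5\<^sup>2 * (p 5)\<^sup>2 + ?s6\<^sup>2 * (p 6)\<^sup>2 - ?s7\<^sup>2 * (\<i> * p 7)\<^sup>2"
    unfolding conj_pair_prod_def scalar_part_cl_mult x_def[symmetric] y_def[symmetric]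
      sum_Pow_123 sgn x y
    by (simp add: power2_eq_square)
  also have "\<dots> = complex_of_real (\<Sum>k=0..7. (p k)\<^sup>2)"
    unfolding power_mult_distrib blade_sign_square seven by simp
  finally show ?thesis .
qed

section \<open>The SSGS coefficients and their averages\<close>

text \<open>Without the length bound, the truncation to \<open>m + 1\<close> coefficients would lose squares.\<close>

lemma sum_ssgs_coeff_squares:
  assumes "length (ssgs x) \<le> Suc m"
  shows "(\<Sum>k=0..m. (ssgs_coeff x k)\<^sup>2) = x"
proof -
  have "(\<Sum>k=0..m. (ssgs_coeff x k)\<^sup>2) = (\<Sum>k=0..<length (ssgs x). (ssgs x ! k)\<^sup>2)"
    using assms by (intro sum.mono_neutral_cong_right) (auto simp: ssgs_coeff_def)
  also have "\<dots> = (\<Sum>r\<leftarrow>ssgs x. r\<^sup>2)"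
    by (simp add: sum_list_sum_nth)
  finally show ?thesis
    by (simp add: ssgs_sum_squares)
qed

lemma square_mean_le_mean_square:
  fixes f :: "nat \<Rightarrow> real"
  assumes "n \<ge> 1"
  shows "(1 / real n * (\<Sum>i=1..n. f i))\<^sup>2 \<le> 1 / real n * (\<Sum>i=1..n. (f i)\<^sup>2)"
  using assms sum_squared_le_sum_of_squares[of f "{1..n}"]
  by (simp add: field_simps power2_eq_square)

theorem mainTheorem1:
  fixes n :: nat and a :: "nat \<Rightarrow> nat"
    and p :: "nat \<Rightarrow> nat \<Rightarrow> nat" and pbar :: "nat \<Rightarrow> real"
  assumes "n \<ge> 1"
    and "\<And>i. i \<in> {1..n} \<Longrightarrow> length (ssgs (a i)) \<le> 8"
    and "\<And>i k. i \<in> {1..n} \<Longrightarrow> k \<le> 7 \<Longrightarrow> p i k = ssgs_coeff (a i) k"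
    and "\<And>k. k \<le> 7 \<Longrightarrow> pbar k = 1 / real n * (\<Sum>i=1..n. real (p i k))"
  shows "1 / real n * (\<Sum>i=1..n. real (a i)) \<ge> Re (conj_pair_prod pbar)
    \<and> conj_pair_prod pbar
        = complex_of_real (\<Sum>k=0..7. (1 / real n * (\<Sum>i=1..n. real (p i k)))\<^sup>2)"
proof -
  have a: "real (a i) = (\<Sum>k=0..7. (real (p i k))\<^sup>2)" if "i \<in> {1..n}" for i
  proof -
    have "a i = (\<Sum>k=0..7. (p i k)\<^sup>2)"
      using sum_ssgs_coeff_squares[of "a i" 7] assms(2)[OF that] assms(3)[OF that] by simp
    thus ?thesis
      by (metis (no_types, lifting) of_nat_power of_nat_sum sum.cong)
  qed
  have prod: "conj_pair_prod pbar
      = complex_of_real (\<Sum>k=0..7. (1 / real n * (\<Sum>i=1..n. real (p i k)))\<^sup>2)"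
    using assms(4) by (simp add: conj_pair_prod_eq_sum_squares)
  hence "Re (conj_pair_prod pbar) = (\<Sum>k=0..7. (1 / real n * (\<Sum>i=1..n. real (p i k)))\<^sup>2)"
    by (simp only: Re_complex_of_real)
  also have "\<dots> \<le> (\<Sum>k=0..7. 1 / real n * (\<Sum>i=1..n. (real (p i k))\<^sup>2))"
    by (intro sum_mono square_mean_le_mean_square assms(1))
  also have "\<dots> = 1 / real n * (\<Sum>i=1..n. \<Sum>k=0..7. (real (p i k))\<^sup>2)"
    by (subst sum.swap) (simp add: sum_distrib_left)
  also have "\<dots> = 1 / real n * (\<Sum>i=1..n. real (a i))"
    by (simp add: a)
  finally show ?thesis
    using prod by blast
qed

end
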